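(* Let $M_1=(E_1,r_1)$ and $M_2=(E_2,r_2)$ be two $q$-matroids with trivially intersecting ground spaces $E_1,E_2$ over the same field, let $E=E_1\oplus E_2$, and let $M=M_1\oplus M_2$ be their direct sum. Then the minors $M|_{E_1}$ and $M/E_2$ are both isomorphic to $M_1$, and the minors $M|_{E_2}$ and $M/E_1$ are both isomorphic to $M_2$.
   Context: A $q$-matroid is a pair $(E,r)$, where $E$ is a finite-dimensional vector space over a field and $r$ is an integer-valued function on the set $\mathcal{L}(E)$ of subspaces of $E$ such that: (R1) $0\le r(A)\le\dim A$ for all $A$; (R2) $A\subseteq B$ implies $r(A)\le r(B)$; (R3) $r(A+B)+r(A\cap B)\le r(A)+r(B)$ for all $A,B$. The notation $r(M;A)$ is the rank of $A$ in the $q$-matroid $M$. Two $q$-matroids $(E_1,r_1)$, $(E_2,r_2)$ over the same field are isomorphic if there is a lattice isomorphism $\varphi:\mathcal{L}(E_1)\to\mathcal{L}(E_2)$ with $r_1(A)=r_2(\varphi(A))$ for all $A\subseteq E_1$. Minors: for a $q$-matroid $M=(E,r)$ and $X\subseteq E$, the restriction $M|_X$ has ground space $X$ and rank function $A\mapsto r(A)$ for $A\subseteq X$; the contraction $M/X$ has ground space $E/X$ and rank function $A/X\mapsto r(A)-r(X)$ for $X\subseteq A\subseteq E$. Matroid union: for $q$-matroids $N_1,N_2$ on the same ground space $E$, the matroid union $N_1\vee N_2$ is the $q$-matroid on $E$ with rank function $r(A)=\min_{X\subseteq A}\{r(N_1;X)+r(N_2;X)+\dim A-\dim X\}$. Direct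 sum: let $E=E_1\oplus E_2$. Let $M_1'$ be the $q$-matroid on $E$ obtained from $M_1$ by adding $\dim E_2$ loops, namely with rank function $r(M_1';A)=r(M_1;(A+E_2)\cap E_1)$; let $M_2'$ be the $q$-matroid on $E$ obtained from $M_2$ by adding $\dim E_1$ loops, namely with rank function $r(M_2';A)=r(M_2;(A+E_1)\cap E_2)$. The direct sum is $M_1\oplus M_2:=M_1'\vee M_2'$. *)

theory Defs
  imports "HOL-Algebra.AbelCoset" "Jordan_Normal_Form.Missing_VectorSpace"
begin

definition subspaces :: "('k, 'l) ring_scheme \<Rightarrow> ('k, 'v) module \<Rightarrow> 'v set set"
  where "subspaces K V = {A. subspace K A V}"

definition sdim :: "('k, 'l) ring_scheme \<Rightarrow> ('k, 'v) module \<Rightarrow> 'v set \<Rightarrow> int"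
  where "sdim K V A = int (vectorspace.dim K (V\<lparr>carrier := A\<rparr>))"

text \<open>
  The vectors of \<open>V / X\<close> are the cosets \<open>X + v\<close>. Adding \<open>X\<close> after scaling a coset \<open>C\<close> by \<open>c\<close> matters
  only for \<open>c = 0\<close>, where the pointwise multiple of \<open>C\<close> is \<open>{0}\<close> instead of \<open>X\<close>.
  The fields \<open>mult\<close> and \<open>one\<close> are part of every module record but play no role for modules.
\<close>

definition quotient_space :: "('k, 'v) module \<Rightarrow> 'v set \<Rightarrow> ('k, 'v set) module"
  where "quotient_space V X =
    \<lparr>carrier = a_rcosets\<^bsub>V\<^esub> X, mult = undefined, one = undefined,
     zero = X, add = (\<lambda>C D. C <+>\<^bsub>V\<^esub> D),
     smult = (\<lambda>c C. X <+>\<^bsub>V\<^esub> ((\<lambda>v. c \<odot>\<^bsub>V\<^esub> v) ` C))\<rparr>"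

definition subspace_quotient :: "('k, 'v) module \<Rightarrow> 'v set \<Rightarrow> 'v set \<Rightarrow> 'v set set"
  where "subspace_quotient V A X = (\<lambda>v. X +>\<^bsub>V\<^esub> v) ` A"

record ('k, 'v) qmat =
  ground :: "('k, 'v) module"
  rank :: "'v set \<Rightarrow> int"

text \<open>Only the values of \<^const>\<open>rank\<close> on subspaces of the ground space are meaningful.\<close>

locale q_matroid = vectorspace K "ground M"
  for K :: "('k, 'l) ring_scheme" and M :: "('k, 'v) qmat" +
  assumes finite_dimensional: "fin_dim"
    and R1: "A \<in> subspaces K (ground M) \<Longrightarrow> 0 \<le> rank M A \<and> rank M A \<le> sdim K (ground M) A"
    and R2: "\<lbrakk>A \<in> subspaces K (ground M); B \<in> subspaces K (ground M); A \<subseteq> B\<rbrakk>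
      \<Longrightarrow> rank M A \<le> rank M B"
    and R3: "\<lbrakk>A \<in> subspaces K (ground M); B \<in> subspaces K (ground M)\<rbrakk>
      \<Longrightarrow> rank M (A <+>\<^bsub>ground M\<^esub> B) + rank M (A \<inter> B) \<le> rank M A + rank M B"

definition lattice_isomorphism ::
    "('k, 'l) ring_scheme \<Rightarrow> ('k, 'v) module \<Rightarrow> ('k, 'w) module \<Rightarrow> ('v set \<Rightarrow> 'w set) \<Rightarrow> bool"
  where "lattice_isomorphism K V W \<phi> \<longleftrightarrow>
    bij_betw \<phi> (subspaces K V) (subspaces K W) \<and>
    (\<forall>A\<in>subspaces K V. \<forall>B\<in>subspaces K V.
       \<phi> (A <+>\<^bsub>V\<^esub> B) = \<phi> A <+>\<^bsub>W\<^esub> \<phi> B \<and> \<phi> (A \<inter> B) = \<phi> A \<inter> \<phi> B)"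

text \<open>Isomorphism is a relation between q-matroids, so both sides are required to be q-matroids.\<close>

definition q_isomorphic ::
    "('k, 'l) ring_scheme \<Rightarrow> ('k, 'v) qmat \<Rightarrow> ('k, 'w) qmat \<Rightarrow> bool"
  where "q_isomorphic K M N \<longleftrightarrow>
    q_matroid K M \<and> q_matroid K N \<and>
    (\<exists>\<phi>. lattice_isomorphism K (ground M) (ground N) \<phi> \<and>
         (\<forall>A\<in>subspaces K (ground M). rank M A = rank N (\<phi> A)))"

definition q_restriction :: "('k, 'v) qmat \<Rightarrow> 'v set \<Rightarrow> ('k, 'v) qmat"
  where "q_restriction M X = \<lparr>ground = (ground M)\<lparr>carrier := X\<rparr>, rank = rank M\<rparr>"

text \<open>
  A subspace of \<open>E / X\<close> has the form \<open>A / X\<close> for a unique subspace \<open>A\<close> of \<open>E\<close> containing \<open>X\<close>, and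
  \<open>A\<close> is the union of the cosets in \<open>A / X\<close>; see \<open>rank_q_contraction\<close> below.
\<close>

definition q_contraction :: "('k, 'v) qmat \<Rightarrow> 'v set \<Rightarrow> ('k, 'v set) qmat"
  where "q_contraction M X =
    \<lparr>ground = quotient_space (ground M) X, rank = (\<lambda>B. rank M (\<Union>B) - rank M X)\<rparr>"

text \<open>
  \<open>q_union\<close> is meant for \<open>N1\<close> and \<open>N2\<close> on the same ground space. For q-matroids, the set whose
  minimum is taken is finite even over an infinite field, since its elements are bounded integers.
\<close>

definition q_union ::
    "('k, 'l) ring_scheme \<Rightarrow> ('k, 'v) qmat \<Rightarrow> ('k, 'v) qmat \<Rightarrow> ('k, 'v) qmat"
  where "q_union K N1 N2 =
    \<lparr>ground = ground N1,
     rank = (\<lambda>A. Min {rank N1 X + rank N2 X + sdim K (ground N1) A - sdim K (ground N1) X | X.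
                       X \<in> subspaces K (ground N1) \<and> X \<subseteq> A})\<rparr>"

text \<open>\<open>M\<close> lives on a subspace of \<open>E\<close> of which \<open>F\<close> is a complement.\<close>

definition add_loops :: "('k, 'v) module \<Rightarrow> ('k, 'v) qmat \<Rightarrow> 'v set \<Rightarrow> ('k, 'v) qmat"
  where "add_loops E M F =
    \<lparr>ground = E, rank = (\<lambda>A. rank M ((A <+>\<^bsub>E\<^esub> F) \<inter> carrier (ground M)))\<rparr>"

text \<open>The internal direct sum, for ground spaces that are complementary subspaces of \<open>E\<close>.\<close>

definition q_direct_sum ::
    "('k, 'l) ring_scheme \<Rightarrow> ('k, 'v) module \<Rightarrow> ('k, 'v) qmat \<Rightarrow> ('k, 'v) qmat \<Rightarrow> ('k, 'v) qmat"
  where "q_direct_sum K E M1 M2 =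
    q_union K (add_loops E M1 (carrier (ground M2))) (add_loops E M2 (carrier (ground M1)))"

lemma subspace_abelian_subgroup:
  assumes "subspace K X V"
  shows "abelian_subgroup X V"
proof -
  interpret vectorspace K V
    using assms by (simp add: subspace_def)
  have sm: "submodule K X V"
    using assms by (simp add: subspace_def)
  interpret S: submodule K X V
    by (rule sm)
  have "subgroup X (add_monoid V)"
  proof (rule add.subgroupI)
    show "X \<subseteq> carrier V" by (rule S.subset)
    show "X \<noteq> {}" using S.zero_closed by blast
    fix a assume a: "a \<in> X"
    then have "a \<in> carrier V" using S.subset by blast
    then have "(\<ominus>\<^bsub>K\<^esub> \<one>\<^bsub>K\<^esub>) \<odot>\<^bsub>V\<^esub> a = \<ominus>\<^bsub>V\<^esub> a"
      by (simp add: smult_l_minus)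
    moreover have "(\<ominus>\<^bsub>K\<^esub> \<one>\<^bsub>K\<^esub>) \<odot>\<^bsub>V\<^esub> a \<in> X"
      using a by (intro S.smult_closed) auto
    ultimately show "\<ominus>\<^bsub>V\<^esub> a \<in> X"
      by simp
  next
    fix a b assume "a \<in> X" "b \<in> X"
    then show "a \<oplus>\<^bsub>V\<^esub> b \<in> X" by simp
  qed
  then show ?thesis
    by (intro abelian_subgroupI3 additive_subgroup.intro abelian_group_axioms)
qed

lemma Union_subspace_quotient:
  assumes "subspace K X V" "subspace K A V" "X \<subseteq> A"
  shows "\<Union>(subspace_quotient V A X) = A"
proof -
  interpret X: abelian_subgroup X V
    by (rule subspace_abelian_subgroup[OF assms(1)])
  interpret A: abelian_subgroup A V
    by (rule subspace_abelian_subgroup[OF assms(2)])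
  have "X +>\<^bsub>V\<^esub> v \<subseteq> A" if "v \<in> A" for v
    using that assms(3) A.a_closed unfolding a_r_coset_def r_coset_def by auto
  moreover have "v \<in> X +>\<^bsub>V\<^esub> v" if "v \<in> A" for v
    using that A.a_subset by (intro X.a_rcos_self) auto
  ultimately show ?thesis
    unfolding subspace_quotient_def by blast
qed

lemma rank_q_contraction:
  assumes "X \<in> subspaces K (ground M)" "A \<in> subspaces K (ground M)" "X \<subseteq> A"
  shows "rank (q_contraction M X) (subspace_quotient (ground M) A X) = rank M A - rank M X"
  using assms Union_subspace_quotient[of K X "ground M" A]
  by (simp add: q_contraction_def subspaces_def)

lemma quotient_smult:
  assumes "subspace K X V" "c \<in> carrier K" "v \<in> carrier V"
  shows "c \<odot>\<^bsub>quotient_space V X\<^esub> (X +>\<^bsub>V\<^esub> v) = X +>\<^bsub>V\<^esub> (c \<odot>\<^bsub>V\<^esub> v)"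
proof -
  interpret vectorspace K V
    using assms by (simp add: subspace_def)
  have sm: "submodule K X V"
    using assms by (simp add: subspace_def)
  interpret S: submodule K X V
    by (rule sm)
  have sub: "x \<in> carrier V" if "x \<in> X" for x using that S.subset by blast
  show ?thesis
  proof (intro equalityI subsetI)
    fix w assume "w \<in> c \<odot>\<^bsub>quotient_space V X\<^esub> (X +>\<^bsub>V\<^esub> v)"
    then obtain x y where xy: "x \<in> X" "y \<in> X" "w = x \<oplus>\<^bsub>V\<^esub> c \<odot>\<^bsub>V\<^esub> (y \<oplus>\<^bsub>V\<^esub> v)"
      by (auto simp: quotient_space_def set_add_def set_mult_def a_r_coset_def r_coset_def)
    then have "w = (x \<oplus>\<^bsub>V\<^esub> c \<odot>\<^bsub>V\<^esub> y) \<oplus>\<^bsub>V\<^esub> c \<odot>\<^bsub>V\<^esub> v"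
      using assms sub by (simp add: smult_r_distr M.a_assoc)
    moreover have "x \<oplus>\<^bsub>V\<^esub> c \<odot>\<^bsub>V\<^esub> y \<in> X"
      using xy assms by simp
    ultimately show "w \<in> X +>\<^bsub>V\<^esub> (c \<odot>\<^bsub>V\<^esub> v)"
      by (auto simp: a_r_coset_def r_coset_def)
  next
    fix w assume "w \<in> X +>\<^bsub>V\<^esub> (c \<odot>\<^bsub>V\<^esub> v)"
    then obtain x where x: "x \<in> X" "w = x \<oplus>\<^bsub>V\<^esub> c \<odot>\<^bsub>V\<^esub> v"
      by (auto simp: a_r_coset_def r_coset_def)
    have "v = \<zero>\<^bsub>V\<^esub> \<oplus>\<^bsub>V\<^esub> v" using assms by simp
    then have "v \<in> X +>\<^bsub>V\<^esub> v"
      using S.zero_closed unfolding a_r_coset_def r_coset_def by auto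
    then show "w \<in> c \<odot>\<^bsub>quotient_space V X\<^esub> (X +>\<^bsub>V\<^esub> v)"
      using x by (auto simp: quotient_space_def set_add_def set_mult_def)
  qed
qed

lemma vectorspace_quotient_space:
  assumes "subspace K X V"
  shows "vectorspace K (quotient_space V X)"
proof -
  interpret vectorspace K V
    using assms by (simp add: subspace_def)
  interpret X: abelian_subgroup X V
    by (rule subspace_abelian_subgroup[OF assms])
  let ?Q = "quotient_space V X"
  have car: "carrier ?Q = {X +>\<^bsub>V\<^esub> v | v. v \<in> carrier V}"
    by (auto simp: quotient_space_def A_RCOSETS_def RCOSETS_def a_r_coset_def)
  have zero: "\<zero>\<^bsub>?Q\<^esub> = X +>\<^bsub>V\<^esub> \<zero>\<^bsub>V\<^esub>"
    using X.a_subset by (simp add: quotient_space_def M.a_coset_add_zero)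
  have add: "(X +>\<^bsub>V\<^esub> v) \<oplus>\<^bsub>?Q\<^esub> (X +>\<^bsub>V\<^esub> w) = X +>\<^bsub>V\<^esub> (v \<oplus>\<^bsub>V\<^esub> w)"
    if "v \<in> carrier V" "w \<in> carrier V" for v w
    using that X.a_rcos_sum by (simp add: quotient_space_def)
  have ab: "abelian_group ?Q"
  proof (rule abelian_groupI)
    show "\<zero>\<^bsub>?Q\<^esub> \<in> carrier ?Q"
      using zero M.zero_closed unfolding car by blast
  next
    fix x assume "x \<in> carrier ?Q"
    then obtain v where v: "v \<in> carrier V" "x = X +>\<^bsub>V\<^esub> v"
      unfolding car by blast
    then show "\<zero>\<^bsub>?Q\<^esub> \<oplus>\<^bsub>?Q\<^esub> x = x"
      by (simp add: zero add)
    have "(X +>\<^bsub>V\<^esub> \<ominus>\<^bsub>V\<^esub> v) \<oplus>\<^bsub>?Q\<^esub> x = \<zero>\<^bsub>?Q\<^esub>"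
      using v by (simp add: zero add M.l_neg)
    then show "\<exists>y\<in>carrier ?Q. y \<oplus>\<^bsub>?Q\<^esub> x = \<zero>\<^bsub>?Q\<^esub>"
      using v unfolding car by blast
  qed (auto simp: car add M.a_ac)
  have "module K ?Q"
    by (rule moduleI)
      (auto simp: car quotient_smult[OF assms] add ab smult_l_distr smult_r_distr smult_assoc1
        intro: R.is_cring)
  then show ?thesis
    by (intro vectorspace.intro field_axioms)
qed

end

theory Submission
  imports Defs "Jordan_Normal_Form.DL_Rank"
begin

text \<open>
  Write \<open>E = E1 \<oplus> E2\<close> and let \<open>M\<close> be the direct sum of \<open>M1\<close> and \<open>M2\<close>. Everything follows from one
  formula: if \<open>A\<close> is spanned by \<open>A \<inter> E1\<close> and \<open>A \<inter> E2\<close>, then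
  \<open>r(M; A) = r(M1; A \<inter> E1) + r(M2; A \<inter> E2)\<close> (\<open>rank_q_direct_sum_split\<close>).

  Here is why. Write \<open>X1 = (X + E2) \<inter> E1\<close> and \<open>X2 = (X + E1) \<inter> E2\<close> for the projections of \<open>X\<close>, so that
  \<open>r(M; A)\<close> is the minimum of \<open>r(M1; X1) + r(M2; X2) + dim A - dim X\<close> over the subspaces \<open>X\<close> of \<open>A\<close>.
  For \<open>X = A\<close> the value is the claimed one, because the projections of such an \<open>A\<close> are \<open>A \<inter> E1\<close> and
  \<open>A \<inter> E2\<close>. No other \<open>X\<close> does better. Indeed, the rank of a q-matroid grows at most as fast as the
  dimension (\<open>rank_increase\<close>), so replacing \<open>A\<close> by \<open>X\<close> lowers the two ranks together by at most
  \<open>dim (A \<inter> E1) + dim (A \<inter> E2) - dim X1 - dim X2\<close>. Since \<open>A \<inter> E1\<close> and \<open>A \<inter> E2\<close> are independent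
  subspaces of \<open>A\<close>, and since \<open>X \<subseteq> X1 + X2\<close>, this is at most \<open>dim A - dim X\<close>, the amount by which the
  remaining term grows.

  The formula applies to every \<open>A \<subseteq> E1\<close>, giving \<open>r(M; A) = r(M1; A)\<close>, and to every \<open>A + E2\<close> with
  \<open>A \<subseteq> E1\<close>, giving \<open>r(M; A + E2) - r(M; E2) = r(M1; A)\<close>. Hence the identity of \<open>E1\<close> and the bijection
  \<open>v \<mapsto> E2 + v\<close> from \<open>E1\<close> onto \<open>E / E2\<close> carry the rank function of \<open>M1\<close> to those of the two minors.
  A linear bijection carries the axioms along with the rank function (\<open>q_isomorphic_transport\<close>), so
  this also shows that the minors are q-matroids. Exchanging the two summands gives the statements
  about \<open>M2\<close>.
\<close>

section \<open>Subspaces and their dimensions\<close>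

context vectorspace
begin

lemma submodule_sum_eq_set_add: "submodule_sum A B = A <+>\<^bsub>V\<^esub> B"
  unfolding submodule_sum_def set_add_def set_mult_def by auto

lemma subspaceI:
  assumes "A \<subseteq> carrier V" "\<zero>\<^bsub>V\<^esub> \<in> A"
    and "\<And>v w. v \<in> A \<Longrightarrow> w \<in> A \<Longrightarrow> v \<oplus>\<^bsub>V\<^esub> w \<in> A"
    and "\<And>c v. c \<in> carrier K \<Longrightarrow> v \<in> A \<Longrightarrow> c \<odot>\<^bsub>V\<^esub> v \<in> A"
  shows "subspace K A V"
  using assms by (intro subspace.intro submodule.intro vectorspace_axioms module_axioms) auto

lemma subspaceD:
  assumes "subspace K A V"
  shows "A \<subseteq> carrier V" "\<zero>\<^bsub>V\<^esub> \<in> A"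
    and "\<And>v w. v \<in> A \<Longrightarrow> w \<in> A \<Longrightarrow> v \<oplus>\<^bsub>V\<^esub> w \<in> A"
    and "\<And>c v. c \<in> carrier K \<Longrightarrow> v \<in> A \<Longrightarrow> c \<odot>\<^bsub>V\<^esub> v \<in> A"
  using assms by (auto simp: subspace_def submodule_def)

lemma subspace_set_add:
  assumes "subspace K A V" "subspace K B V"
  shows "subspace K (A <+>\<^bsub>V\<^esub> B) V"
  using sum_is_subspace[OF assms] by (simp add: submodule_sum_eq_set_add)

lemma set_add_commute:
  assumes "subspace K A V" "subspace K B V"
  shows "A <+>\<^bsub>V\<^esub> B = B <+>\<^bsub>V\<^esub> A"
  using vsum_comm[OF assms] unfolding submodule_sum_eq_set_add .

lemma subspace_Int:
  assumes "subspace K A V" "subspace K B V"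
  shows "subspace K (A \<inter> B) V"
  using subspaceD[OF assms(1)] subspaceD[OF assms(2)] by (intro subspaceI) auto

lemma subspace_zero: "subspace K {\<zero>\<^bsub>V\<^esub>} V"
  by (intro subspaceI) auto

lemma subset_set_add:
  assumes "subspace K A V" "subspace K B V"
  shows "A \<subseteq> A <+>\<^bsub>V\<^esub> B" "B \<subseteq> A <+>\<^bsub>V\<^esub> B"
  using in_sum_vs[OF assms] in_sum_vs[OF assms(2,1)] set_add_commute[OF assms]
  by (simp_all add: submodule_sum_eq_set_add)

end

text \<open>
  \<^const>\<open>subspaces\<close>, \<^const>\<open>sdim\<close> and \<^const>\<open>quotient_space\<close> take module records without extra fields,
  whereas the locale \<^locale>\<open>vectorspace\<close> is about arbitrary extensions of such records.
\<close>

locale plain_vectorspace = vectorspace K V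
  for K :: "('k, 'l) ring_scheme" and V :: "('k, 'v) module"
begin

lemma subspaces_vs:
  assumes "subspace K W V"
  shows "subspaces K (vs W) = {A \<in> subspaces K V. A \<subseteq> W}"
proof -
  interpret W: vectorspace K "vs W"
    using assms by (rule subspace_is_vs)
  have "subspace K A V" "A \<subseteq> W" if "subspace K A (vs W)" for A
    using W.subspaceD[OF that] subspaceD[OF assms] by (auto intro!: subspaceI)
  moreover have "subspace K A (vs W)" if "subspace K A V" "A \<subseteq> W" for A
    by (rule nested_subspaces[OF assms that])
  ultimately show ?thesis
    by (auto simp: subspaces_def)
qed

text \<open>
  Independent subsets of \<open>W\<close> are independent in \<open>V\<close>, so their sizes are bounded by \<open>dim V\<close> and a
  maximal one exists. It is a basis of \<open>W\<close>.
\<close>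

lemma fin_dim_subspace:
  assumes "fin_dim" "subspace K W V"
  shows "vectorspace.fin_dim K (vs W)"
proof -
  interpret W: vectorspace K "vs W"
    using assms(2) by (rule subspace_is_vs)
  have W: "W \<subseteq> carrier V" "submodule K W V"
    using assms(2) subspaceD by auto
  let ?P = "\<lambda>S. S \<subseteq> W \<and> W.lin_indpt S"
  have "finite S \<and> card S \<le> dim" if "?P S" for S
    using that li_le_dim[OF assms(1), of S] W span_li_not_depend(2)[of S W] by auto
  moreover have "?P {}"
    by (auto simp: W.lin_dep_def)
  ultimately obtain S where S: "finite S" "maximal S ?P"
    using maximal_exists[of ?P dim "{}"] by blast
  then have "W.basis S"
    by (intro W.max_li_is_basis) simp
  with S(1) show ?thesis
    unfolding W.fin_dim_def W.basis_def by blast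
qed

lemma sdim_mono:
  assumes "fin_dim" "subspace K A V" "subspace K B V" "A \<subseteq> B"
  shows "sdim K V A \<le> sdim K V B"
proof -
  interpret B: vectorspace K "vs B"
    using assms(3) by (rule subspace_is_vs)
  show ?thesis
    using B.subspace_dim[of A] nested_subspaces[OF assms(3,2,4)] fin_dim_subspace assms
    by (simp add: sdim_def)
qed

lemma sdim_set_add_le:
  assumes "fin_dim" "subspace K A V" "subspace K B V"
  shows "sdim K V (A <+>\<^bsub>V\<^esub> B) \<le> sdim K V A + sdim K V B"
  using dim_subadditive[of A B] fin_dim_subspace assms
  by (simp add: sdim_def submodule_sum_eq_set_add)

text \<open>
  The exchange lemma enlarges a basis of \<open>A\<close> to a generating set by at most \<open>dim V - dim A\<close> vectors,
  and \<open>C\<close> is their span.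
\<close>

lemma exists_small_supplement:
  assumes "fin_dim" "subspace K A V"
  shows "\<exists>C. subspace K C V \<and> A <+>\<^bsub>V\<^esub> C = carrier V \<and> sdim K V C \<le> int dim - sdim K V A"
proof -
  interpret A: vectorspace K "vs A"
    using assms(2) by (rule subspace_is_vs)
  obtain B where B: "finite B" "basis B"
    using finite_basis_exists[OF assms(1)] by blast
  obtain S where S: "finite S" "A.basis S"
    using A.finite_basis_exists fin_dim_subspace[OF assms] by blast
  have sub: "submodule K A V" "A \<subseteq> carrier V"
    using assms(2) subspaceD by auto
  have SA: "S \<subseteq> A" "lin_indpt S" "span S = A"
    using S(2) span_li_not_depend[of S A] sub by (auto simp: A.basis_def)
  have gen: "span B = carrier V" and BV: "B \<subseteq> carrier V"
    using B by (auto simp: basis_def)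
  obtain C where C: "finite C" "C \<subseteq> carrier V"
      "int (card C) \<le> int (card B) - int (card S)" "span (S \<union> C) = carrier V"
    using replacement[of S B] B(1) S(1) SA sub(2) gen BV by (metis subset_trans)
  have sC: "subspace K (span C) V"
    using C by (intro span_is_subspace)
  interpret C: vectorspace K "vs (span C)"
    using sC by (rule subspace_is_vs)
  have "C.dim \<le> card C"
    using C sC by (intro C.gen_ge_dim) (auto simp: in_own_span span_li_not_depend(1))
  then have "sdim K V (span C) \<le> int dim - sdim K V A"
    using C(3) dim_basis[OF B] A.dim_basis[OF S] by (simp add: sdim_def)
  moreover have "A <+>\<^bsub>V\<^esub> span C = carrier V"
    using span_union_is_sum[of S C] SA sub C by (auto simp: submodule_sum_eq_set_add)
  ultimately show ?thesis
    using sC by blast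
qed

lemma quotient_map_linear:
  assumes "subspace K X V"
  shows "linear_map K V (quotient_space V X) (\<lambda>v. X +>\<^bsub>V\<^esub> v)"
proof -
  interpret X: abelian_subgroup X V
    by (rule subspace_abelian_subgroup[OF assms])
  interpret Q: vectorspace K "quotient_space V X"
    by (rule vectorspace_quotient_space[OF assms])
  have "(\<lambda>v. X +>\<^bsub>V\<^esub> v) \<in> LinearCombinations.module_hom K V (quotient_space V X)"
    unfolding LinearCombinations.module_hom_def
    using quotient_smult[OF assms] X.a_rcos_sum X.a_subset
    by (auto simp: quotient_space_def intro: M.a_rcosetsI)
  then show ?thesis
    by (intro linear_map.intro mod_hom.intro mod_hom_axioms.intro vectorspace_axioms
        Q.vectorspace_axioms module_axioms Q.module_axioms)
qed

lemma linear_map_restrict: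
  assumes "linear_map K V W T" "subspace K A V"
  shows "linear_map K (V\<lparr>carrier := A\<rparr>) W T"
proof -
  interpret T: linear_map K V W T
    by (rule assms(1))
  have W: "vectorspace K W" "module K W"
    using T.W.vectorspace_axioms by (auto simp: vectorspace_def)
  interpret A: vectorspace K "vs A"
    by (rule subspace_is_vs[OF assms(2)])
  have "T \<in> LinearCombinations.module_hom K (vs A) W"
    using subspaceD(1)[OF assms(2)] by (auto simp: LinearCombinations.module_hom_def subset_iff)
  then show ?thesis
    by (intro linear_map.intro mod_hom.intro mod_hom_axioms.intro A.vectorspace_axioms
        W A.module_axioms)
qed

end

locale complementary_subspaces = plain_vectorspace K V
  for K :: "('k, 'l) ring_scheme" and V :: "('k, 'v) module" +
  fixes P Q :: "'v set"
  assumes subspace_P: "subspace K P V" and subspace_Q: "subspace K Q V"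
    and Int_trivial: "P \<inter> Q = {\<zero>\<^bsub>V\<^esub>}"
    and set_add_carrier: "P <+>\<^bsub>V\<^esub> Q = carrier V"
begin

lemma decompose:
  assumes "v \<in> carrier V"
  obtains p q where "p \<in> P" "q \<in> Q" "v = p \<oplus>\<^bsub>V\<^esub> q"
  using assms[folded set_add_carrier] by (auto simp: set_add_def')

lemma decomposition_unique:
  assumes "p \<in> P" "p' \<in> P" "q \<in> Q" "q' \<in> Q" "p \<oplus>\<^bsub>V\<^esub> q = p' \<oplus>\<^bsub>V\<^esub> q'"
  shows "p = p'" "q = q'"
proof -
  interpret P: abelian_subgroup P V
    by (rule subspace_abelian_subgroup[OF subspace_P])
  interpret Q: abelian_subgroup Q V
    by (rule subspace_abelian_subgroup[OF subspace_Q])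
  have c: "p \<in> carrier V" "p' \<in> carrier V" "q \<in> carrier V" "q' \<in> carrier V"
    using assms P.a_subset Q.a_subset by auto
  have "p = p \<oplus>\<^bsub>V\<^esub> q \<oplus>\<^bsub>V\<^esub> \<ominus>\<^bsub>V\<^esub> q"
    using c by (simp add: M.a_assoc M.r_neg)
  also have "\<dots> = p' \<oplus>\<^bsub>V\<^esub> (q' \<oplus>\<^bsub>V\<^esub> \<ominus>\<^bsub>V\<^esub> q)"
    using c by (simp add: assms(5) M.a_assoc)
  finally have "\<ominus>\<^bsub>V\<^esub> p' \<oplus>\<^bsub>V\<^esub> p = \<ominus>\<^bsub>V\<^esub> p' \<oplus>\<^bsub>V\<^esub> (p' \<oplus>\<^bsub>V\<^esub> (q' \<oplus>\<^bsub>V\<^esub> \<ominus>\<^bsub>V\<^esub> q))"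
    by simp
  then have "\<ominus>\<^bsub>V\<^esub> p' \<oplus>\<^bsub>V\<^esub> p = q' \<oplus>\<^bsub>V\<^esub> \<ominus>\<^bsub>V\<^esub> q"
    using c by (simp add: M.r_neg1)
  moreover have "\<ominus>\<^bsub>V\<^esub> p' \<oplus>\<^bsub>V\<^esub> p \<in> P" "q' \<oplus>\<^bsub>V\<^esub> \<ominus>\<^bsub>V\<^esub> q \<in> Q"
    using assms by auto
  ultimately have "\<ominus>\<^bsub>V\<^esub> p' \<oplus>\<^bsub>V\<^esub> p = \<zero>\<^bsub>V\<^esub>"
    using Int_trivial by auto
  then show "p = p'"
    using c by (metis M.minus_equality M.minus_minus M.a_inv_closed)
  then show "q = q'"
    using assms(5) c by simp
qed

text \<open>
  The second isomorphism theorem for \<open>V = P \<oplus> Q\<close>: each coset of \<open>Q\<close> meets \<open>P\<close> in exactly one vector.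
\<close>

lemma quotient_map_bij: "bij_betw (\<lambda>v. Q +>\<^bsub>V\<^esub> v) P (carrier (quotient_space V Q))"
proof -
  interpret Q: abelian_subgroup Q V
    by (rule subspace_abelian_subgroup[OF subspace_Q])
  have sub: "P \<subseteq> carrier V" "Q \<subseteq> carrier V"
    using subspace_P subspace_Q subspaceD by auto
  have coset: "Q +>\<^bsub>V\<^esub> v = {q \<oplus>\<^bsub>V\<^esub> v |q. q \<in> Q}" for v
    by (auto simp: a_r_coset_def')
  have "inj_on (\<lambda>v. Q +>\<^bsub>V\<^esub> v) P"
  proof (rule inj_onI)
    fix v w assume vw: "v \<in> P" "w \<in> P" "Q +>\<^bsub>V\<^esub> v = Q +>\<^bsub>V\<^esub> w"
    then have "v \<in> Q +>\<^bsub>V\<^esub> w"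
      using Q.a_rcos_self[of v] sub by auto
    then obtain q where "q \<in> Q" "v = q \<oplus>\<^bsub>V\<^esub> w"
      by (auto simp: coset)
    then show "v = w"
      using decomposition_unique(1)[of v w "\<zero>\<^bsub>V\<^esub>" q] vw sub
      by (auto simp: M.a_comm subset_iff)
  qed
  moreover have "C \<in> (\<lambda>v. Q +>\<^bsub>V\<^esub> v) ` P" if C: "C \<in> carrier (quotient_space V Q)" for C
  proof -
    obtain v where v: "v \<in> carrier V" "C = Q +>\<^bsub>V\<^esub> v"
      using C by (auto simp: quotient_space_def A_RCOSETS_def')
    then obtain p q where pq: "p \<in> P" "q \<in> Q" "v = q \<oplus>\<^bsub>V\<^esub> p"
      using decompose[of v] sub by (metis M.a_comm subset_iff)
    then have "v \<in> Q +>\<^bsub>V\<^esub> p"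
      by (auto simp: coset)
    then have "C = Q +>\<^bsub>V\<^esub> p"
      using v pq sub by (metis Q.a_repr_independence' subset_iff)
    then show ?thesis
      using pq by blast
  qed
  moreover have "(\<lambda>v. Q +>\<^bsub>V\<^esub> v) ` P \<subseteq> carrier (quotient_space V Q)"
    using sub by (auto simp: quotient_space_def intro: M.a_rcosetsI)
  ultimately show ?thesis
    by (auto simp: bij_betw_def)
qed

text \<open>
  Rank-nullity for the quotient map by \<open>Q\<close>: its kernel is \<open>Q\<close>, and it maps \<open>P\<close> bijectively onto its
  image.
\<close>

lemma dim_add:
  assumes "fin_dim"
  shows "sdim K V P + sdim K V Q = int dim"
proof -
  let ?W = "quotient_space V Q" and ?T = "\<lambda>v. Q +>\<^bsub>V\<^esub> v"
  interpret Q: abelian_subgroup Q V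
    by (rule subspace_abelian_subgroup[OF subspace_Q])
  interpret T: linear_map K V ?W ?T
    by (rule quotient_map_linear[OF subspace_Q])
  interpret TP: linear_map K "vs P" ?W ?T
    by (rule linear_map_restrict[OF T.linear_map_axioms subspace_P])
  have sub: "P \<subseteq> carrier V" "Q \<subseteq> carrier V"
    using subspace_P subspace_Q subspaceD by auto
  have zero: "\<zero>\<^bsub>?W\<^esub> = Q"
    by (simp add: quotient_space_def)
  have "T.im = carrier ?W"
    using quotient_map_bij sub T.T_im unfolding T.im_def bij_betw_def by blast
  moreover have "T.ker = Q"
  proof (intro equalityI subsetI)
    fix v assume "v \<in> T.ker"
    then show "v \<in> Q"
      using Q.a_rcos_self[of v] by (simp add: T.ker_def zero)
  next
    fix v assume "v \<in> Q"
    then show "v \<in> T.ker"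
      using Q.a_rcos_const[of v] sub by (auto simp: T.ker_def zero)
  qed
  ultimately have "T.W.dim + vectorspace.dim K (vs Q) = dim"
    using T.rank_nullity[OF assms] by simp
  moreover have "vectorspace.dim K (vs P) = T.W.dim"
    using quotient_map_bij fin_dim_subspace[OF assms subspace_P]
    by (intro TP.dim_eq) (auto simp: bij_betw_def)
  ultimately show ?thesis
    by (simp add: sdim_def)
qed

end

text \<open>
  Inside the space \<open>P + Q\<close>, the two subspaces are complementary.
\<close>

lemma (in plain_vectorspace) sdim_set_add_disjoint:
  assumes "fin_dim" "subspace K P V" "subspace K Q V" "P \<inter> Q = {\<zero>\<^bsub>V\<^esub>}"
  shows "sdim K V (P <+>\<^bsub>V\<^esub> Q) = sdim K V P + sdim K V Q"
proof -
  let ?S = "P <+>\<^bsub>V\<^esub> Q"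
  have S: "subspace K ?S V"
    using assms by (intro subspace_set_add)
  interpret S: vectorspace K "vs ?S"
    by (rule subspace_is_vs[OF S])
  have "complementary_subspaces K (vs ?S) P Q"
  proof (intro complementary_subspaces.intro plain_vectorspace.intro S.vectorspace_axioms
        complementary_subspaces_axioms.intro)
    show "subspace K P (vs ?S)" "subspace K Q (vs ?S)"
      by (rule nested_subspaces[OF S assms(2) subset_set_add(1)[OF assms(2,3)]],
          rule nested_subspaces[OF S assms(3) subset_set_add(2)[OF assms(2,3)]])
    show "P \<inter> Q = {\<zero>\<^bsub>vs ?S\<^esub>}"
      using assms(4) by simp
    show "P <+>\<^bsub>vs ?S\<^esub> Q = carrier (vs ?S)"
      by (simp add: set_add_def')
  qed
  then show ?thesis
    using complementary_subspaces.dim_add[of K "vs ?S" P Q] fin_dim_subspace[OF assms(1) S]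
    by (simp add: sdim_def)
qed

section \<open>The rank grows at most as fast as the dimension\<close>

sublocale q_matroid \<subseteq> plain_vectorspace K "ground M" ..

text \<open>
  Submodularity applied to \<open>A\<close> and a supplement \<open>C\<close> of \<open>A\<close> in \<open>B\<close>: the rank of \<open>C\<close> is at most its
  dimension, and the rank of \<open>A \<inter> C\<close> is nonnegative.
\<close>

lemma (in q_matroid) rank_increase:
  assumes "A \<in> subspaces K (ground M)" "B \<in> subspaces K (ground M)" "A \<subseteq> B"
  shows "rank M B \<le> rank M A + (sdim K (ground M) B - sdim K (ground M) A)"
proof -
  have A: "subspace K A (ground M)" and B: "subspace K B (ground M)"
    using assms by (auto simp: subspaces_def)
  interpret B: vectorspace K "vs B"
    by (rule subspace_is_vs[OF B])
  interpret B: plain_vectorspace K "vs B" ..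
  obtain C where C: "subspace K C (vs B)" "A <+>\<^bsub>vs B\<^esub> C = B"
      "sdim K (vs B) C \<le> int B.dim - sdim K (vs B) A"
    using B.exists_small_supplement[OF fin_dim_subspace[OF finite_dimensional B] nested_subspaces[OF B A assms(3)]]
    by auto
  then have C': "C \<in> subspaces K (ground M)" "A <+>\<^bsub>ground M\<^esub> C = B"
      "sdim K (ground M) C \<le> sdim K (ground M) B - sdim K (ground M) A"
    using subspaces_vs[OF B] by (auto simp: subspaces_def sdim_def set_add_def')
  have "A \<inter> C \<in> subspaces K (ground M)"
    using A C'(1) subspace_Int by (simp add: subspaces_def)
  then show ?thesis
    using R3[OF assms(1) C'(1)] R1[OF C'(1)] R1[of "A \<inter> C"] C' by simp
qed

section \<open>Transport along linear bijections\<close>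

locale linear_bijection = linear_map K V W T
  for K :: "('k, 'l) ring_scheme" and V :: "('k, 'v) module" and W :: "('k, 'w) module" and T +
  assumes bij: "bij_betw T (carrier V) (carrier W)"
begin

sublocale dom: plain_vectorspace K V ..

sublocale cod: plain_vectorspace K W ..

lemma T_image_carrier: "T ` carrier V = carrier W"
  using bij by (simp add: bij_betw_def)

lemma T_inj: "inj_on T (carrier V)"
  using bij by (simp add: bij_betw_def)

lemma subspace_image:
  assumes "subspace K A V"
  shows "subspace K (T ` A) W"
proof -
  interpret A: linear_map K "V\<lparr>carrier := A\<rparr>" W T
    by (rule dom.linear_map_restrict[OF linear_map_axioms assms])
  show ?thesis
    using A.imT_is_subspace by (simp add: A.im_def)
qed

lemma subspace_vimage:
  assumes "subspace K B W"
  shows "subspace K (T -` B \<inter> carrier V) V"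
  using W.subspaceD[OF assms] by (intro V.subspaceI) auto

lemma sdim_image:
  assumes "V.fin_dim" "subspace K A V"
  shows "sdim K W (T ` A) = sdim K V A"
proof -
  interpret TA: vectorspace K "W\<lparr>carrier := T ` A\<rparr>"
    by (rule W.subspace_is_vs[OF subspace_image[OF assms(2)]])
  interpret A: linear_map K "V\<lparr>carrier := A\<rparr>" W T
    by (rule dom.linear_map_restrict[OF linear_map_axioms assms(2)])
  have "A.V.dim = vectorspace.dim K (W\<lparr>carrier := A.im\<rparr>) + 0"
    using A.rank_nullity[OF dom.fin_dim_subspace[OF assms]] A.inj_imp_dim_ker0
      inj_on_subset[OF T_inj] V.subspaceD(1)[OF assms(2)] by auto
  then show ?thesis
    by (simp add: sdim_def A.im_def)
qed

lemma lattice_isomorphism_image: "lattice_isomorphism K V W ((`) T)"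
  unfolding lattice_isomorphism_def
proof (intro conjI ballI)
  have "inj_on ((`) T) (Pow (carrier V))"
    using T_inj by (rule inj_on_image_Pow)
  then have "inj_on ((`) T) (subspaces K V)"
    by (rule inj_on_subset) (auto simp: subspaces_def dest: V.subspaceD(1))
  moreover have "B \<in> (`) T ` subspaces K V" if "B \<in> subspaces K W" for B
  proof
    show "T -` B \<inter> carrier V \<in> subspaces K V"
      using that subspace_vimage by (simp add: subspaces_def)
    have "T ` (T -` B \<inter> carrier V) = B \<inter> carrier W"
      unfolding T_image_carrier[symmetric] by blast
    then show "B = T ` (T -` B \<inter> carrier V)"
      using that W.subspaceD(1)[of B] by (simp add: subspaces_def Int_absorb2)
  qed
  ultimately show "bij_betw ((`) T) (subspaces K V) (subspaces K W)"
    using subspace_image by (auto simp: bij_betw_def subspaces_def)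
next
  fix A B assume "A \<in> subspaces K V" "B \<in> subspaces K V"
  then have sub: "A \<subseteq> carrier V" "B \<subseteq> carrier V"
    using V.subspaceD(1) by (auto simp: subspaces_def)
  have add: "T (a \<oplus>\<^bsub>V\<^esub> b) = T a \<oplus>\<^bsub>W\<^esub> T b" if "a \<in> A" "b \<in> B" for a b
    using that sub by (simp add: subset_iff)
  show "T ` (A <+>\<^bsub>V\<^esub> B) = T ` A <+>\<^bsub>W\<^esub> T ` B"
    by (auto simp: set_add_def' image_UN add)
  show "T ` (A \<inter> B) = T ` A \<inter> T ` B"
    using T_inj sub by (rule inj_on_image_Int)
qed

end

lemma lattice_isomorphism_inv:
  assumes "lattice_isomorphism K V W \<phi>" "vectorspace K V"
  shows "lattice_isomorphism K W V (inv_into (subspaces K V) \<phi>)"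
proof -
  interpret vectorspace K V
    by (rule assms(2))
  let ?\<psi> = "inv_into (subspaces K V) \<phi>"
  have bij: "bij_betw \<phi> (subspaces K V) (subspaces K W)"
    using assms(1) by (simp add: lattice_isomorphism_def)
  have inv: "?\<psi> (\<phi> A) = A" if "A \<in> subspaces K V" for A
    using bij that by (auto simp: bij_betw_def)
  have "?\<psi> (C <+>\<^bsub>W\<^esub> D) = ?\<psi> C <+>\<^bsub>V\<^esub> ?\<psi> D \<and> ?\<psi> (C \<inter> D) = ?\<psi> C \<inter> ?\<psi> D"
    if CD: "C \<in> subspaces K W" "D \<in> subspaces K W" for C D
  proof -
    have "C \<in> \<phi> ` subspaces K V" "D \<in> \<phi> ` subspaces K V"
      using CD bij by (simp_all add: bij_betw_def)
    then obtain A B where AB: "A \<in> subspaces K V" "B \<in> subspaces K V" "C = \<phi> A" "D = \<phi> B"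
      by (elim imageE) simp
    have closed: "A <+>\<^bsub>V\<^esub> B \<in> subspaces K V" "A \<inter> B \<in> subspaces K V"
      using AB subspace_set_add subspace_Int by (auto simp: subspaces_def)
    have hom: "\<phi> A <+>\<^bsub>W\<^esub> \<phi> B = \<phi> (A <+>\<^bsub>V\<^esub> B)" "\<phi> A \<inter> \<phi> B = \<phi> (A \<inter> B)"
      using assms(1) AB(1,2) by (simp_all add: lattice_isomorphism_def)
    show ?thesis
      unfolding AB(3,4) hom inv[OF AB(1)] inv[OF AB(2)] inv[OF closed(1)] inv[OF closed(2)]
      by (intro conjI refl)
  qed
  then show ?thesis
    using bij_betw_inv_into[OF bij] by (simp add: lattice_isomorphism_def)
qed

text \<open>
  \<^const>\<open>q_isomorphic\<close> demands that both sides be q-matroids. Each axiom for \<open>N\<close> is the image of the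
  axiom for \<open>M\<close>, since \<open>T\<close> preserves sums, intersections, inclusions and dimensions.
\<close>

lemma q_isomorphic_transport:
  assumes "q_matroid K M" "linear_bijection K (ground M) (ground N) T"
    and rank: "\<And>A. A \<in> subspaces K (ground M) \<Longrightarrow> rank N (T ` A) = rank M A"
  shows "q_isomorphic K N M"
proof -
  interpret M: q_matroid K M
    by (rule assms(1))
  interpret T: linear_bijection K "ground M" "ground N" T
    by (rule assms(2))
  let ?\<phi> = "inv_into (subspaces K (ground M)) ((`) T)"
  note iso = T.lattice_isomorphism_image
  have hom: "T ` (A <+>\<^bsub>ground M\<^esub> B) = T ` A <+>\<^bsub>ground N\<^esub> T ` B" "T ` (A \<inter> B) = T ` A \<inter> T ` B"
    if "A \<in> subspaces K (ground M)" "B \<in> subspaces K (ground M)" for A B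
    using iso that by (auto simp: lattice_isomorphism_def)
  have bij: "bij_betw ((`) T) (subspaces K (ground M)) (subspaces K (ground N))"
    using iso by (simp add: lattice_isomorphism_def)
  then have image: "subspaces K (ground N) = (`) T ` subspaces K (ground M)"
    by (simp add: bij_betw_def)
  have closed: "A <+>\<^bsub>ground M\<^esub> B \<in> subspaces K (ground M)" "A \<inter> B \<in> subspaces K (ground M)"
    if "A \<in> subspaces K (ground M)" "B \<in> subspaces K (ground M)" for A B
    using that M.subspace_set_add M.subspace_Int by (auto simp: subspaces_def)
  have "q_matroid K N"
  proof
    show "T.W.fin_dim"
      using T.surj_fin_dim[OF M.finite_dimensional T.T_image_carrier] .
  next
    fix C assume "C \<in> subspaces K (ground N)"
    then show "0 \<le> rank N C \<and> rank N C \<le> sdim K (ground N) C"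
      using M.R1 T.sdim_image[OF M.finite_dimensional] rank unfolding image
      by (auto simp: subspaces_def)
  next
    fix C D assume "C \<in> subspaces K (ground N)" "D \<in> subspaces K (ground N)" "C \<subseteq> D"
    then obtain A B where AB: "A \<in> subspaces K (ground M)" "B \<in> subspaces K (ground M)"
        "C = T ` A" "D = T ` B" "T ` A \<subseteq> T ` B"
      unfolding image by blast
    moreover have "A \<subseteq> carrier (ground M)" "B \<subseteq> carrier (ground M)"
      using AB M.subspaceD(1) by (auto simp: subspaces_def)
    ultimately have "A \<subseteq> B"
      using inj_on_image_mem_iff[OF T.T_inj] by blast
    then show "rank N C \<le> rank N D"
      using AB M.R2 rank by simp
  next
    fix C D assume "C \<in> subspaces K (ground N)" "D \<in> subspaces K (ground N)"
    then obtain A B where AB: "A \<in> subspaces K (ground M)" "B \<in> subspaces K (ground M)"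
      and CD: "C = T ` A" "D = T ` B"
      unfolding image by blast
    then show "rank N (C <+>\<^bsub>ground N\<^esub> D) + rank N (C \<inter> D) \<le> rank N C + rank N D"
      using M.R3[OF AB] unfolding CD hom(1)[OF AB, symmetric] hom(2)[OF AB, symmetric]
        rank[OF AB(1)] rank[OF AB(2)] rank[OF closed(1)[OF AB]] rank[OF closed(2)[OF AB]] by simp
  qed
  moreover have "rank N C = rank M (?\<phi> C)" if "C \<in> subspaces K (ground N)" for C
  proof -
    have "?\<phi> C \<in> subspaces K (ground M)" "T ` ?\<phi> C = C"
      using that unfolding image by (rule inv_into_into, rule f_inv_into_f)
    then show ?thesis
      using rank by metis
  qed
  ultimately show ?thesis
    unfolding q_isomorphic_def
    by (intro conjI exI[of _ ?\<phi>] ballI assms(1) lattice_isomorphism_inv[OF iso M.vectorspace_axioms])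
qed

section \<open>Projections onto complementary subspaces\<close>

context complementary_subspaces
begin

lemma complementary_swap: "complementary_subspaces K V Q P"
proof -
  have "Q <+>\<^bsub>V\<^esub> P = carrier V"
    unfolding set_add_carrier[symmetric] by (rule set_add_commute[OF subspace_Q subspace_P])
  moreover have "Q \<inter> P = {\<zero>\<^bsub>V\<^esub>}"
    using Int_trivial by (simp add: Int_commute[of Q])
  ultimately show ?thesis
    by (intro complementary_subspaces.intro plain_vectorspace_axioms
        complementary_subspaces_axioms.intro subspace_P subspace_Q)
qed

text \<open>
  \<open>(A + Q) \<inter> P\<close> is the projection of \<open>A\<close> to \<open>P\<close> along \<open>Q\<close>. It always contains \<open>A \<inter> P\<close>; equality means
  that \<open>A\<close> contains the \<open>P\<close>-components of its vectors, which the hypothesis on \<open>A\<close> says.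
\<close>

lemma projection_of_split:
  assumes "subspace K A V" "A \<subseteq> (A \<inter> P) <+>\<^bsub>V\<^esub> (A \<inter> Q)"
  shows "(A <+>\<^bsub>V\<^esub> Q) \<inter> P = A \<inter> P"
proof
  have sub: "P \<subseteq> carrier V" "Q \<subseteq> carrier V"
    using subspace_P subspace_Q subspaceD by auto
  show "A \<inter> P \<subseteq> (A <+>\<^bsub>V\<^esub> Q) \<inter> P"
    using subset_set_add(1)[OF assms(1) subspace_Q] by blast
  show "(A <+>\<^bsub>V\<^esub> Q) \<inter> P \<subseteq> A \<inter> P"
  proof
    fix v assume v: "v \<in> (A <+>\<^bsub>V\<^esub> Q) \<inter> P"
    then obtain a q where aq: "a \<in> A" "q \<in> Q" "v = a \<oplus>\<^bsub>V\<^esub> q"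
      by (auto simp: set_add_def')
    obtain p q' where pq: "p \<in> A" "p \<in> P" "q' \<in> Q" "a = p \<oplus>\<^bsub>V\<^esub> q'"
      using aq(1) assms(2) by (auto simp: set_add_def')
    have "v \<oplus>\<^bsub>V\<^esub> \<zero>\<^bsub>V\<^esub> = p \<oplus>\<^bsub>V\<^esub> (q' \<oplus>\<^bsub>V\<^esub> q)"
      using v aq pq sub by (simp add: M.a_assoc subset_iff)
    then have "v = p"
      using decomposition_unique(1)[of v p "\<zero>\<^bsub>V\<^esub>" "q' \<oplus>\<^bsub>V\<^esub> q"] v aq pq subspaceD[OF subspace_Q]
      by blast
    then show "v \<in> A \<inter> P"
      using pq by simp
  qed
qed

text \<open>
  If \<open>v = p + q\<close> lies in \<open>A\<close>, then \<open>p = v - q\<close> lies in \<open>A + Q\<close> and \<open>q = v - p\<close> in \<open>A + P\<close>.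
\<close>

lemma subset_add_projections:
  assumes "A \<subseteq> carrier V"
  shows "A \<subseteq> ((A <+>\<^bsub>V\<^esub> Q) \<inter> P) <+>\<^bsub>V\<^esub> ((A <+>\<^bsub>V\<^esub> P) \<inter> Q)"
proof
  fix v assume v: "v \<in> A"
  interpret P: abelian_subgroup P V
    by (rule subspace_abelian_subgroup[OF subspace_P])
  interpret Q: abelian_subgroup Q V
    by (rule subspace_abelian_subgroup[OF subspace_Q])
  obtain p q where pq: "p \<in> P" "q \<in> Q" "v = p \<oplus>\<^bsub>V\<^esub> q"
    using decompose v assms by blast
  have c: "p \<in> carrier V" "q \<in> carrier V"
    using pq P.a_subset Q.a_subset by auto
  have "p = v \<oplus>\<^bsub>V\<^esub> \<ominus>\<^bsub>V\<^esub> q"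
    using c by (simp add: pq(3) M.a_assoc M.r_neg)
  moreover have "q = v \<oplus>\<^bsub>V\<^esub> \<ominus>\<^bsub>V\<^esub> p"
  proof -
    have "v = q \<oplus>\<^bsub>V\<^esub> p"
      using c pq(3) by (simp add: M.a_comm)
    then show ?thesis
      using c by (simp add: M.a_assoc M.r_neg)
  qed
  moreover have "\<ominus>\<^bsub>V\<^esub> q \<in> Q" "\<ominus>\<^bsub>V\<^esub> p \<in> P"
    using pq by auto
  ultimately have "p \<in> A <+>\<^bsub>V\<^esub> Q" "q \<in> A <+>\<^bsub>V\<^esub> P"
    using v unfolding set_add_def' by blast+
  then show "v \<in> ((A <+>\<^bsub>V\<^esub> Q) \<inter> P) <+>\<^bsub>V\<^esub> ((A <+>\<^bsub>V\<^esub> P) \<inter> Q)"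
    using pq unfolding set_add_def' by blast
qed

end

text \<open>
  The zero space is the direct sum of two copies of itself, so its dimension \<open>d\<close> satisfies \<open>d = d + d\<close>.
\<close>

lemma (in plain_vectorspace) sdim_zero:
  assumes "fin_dim"
  shows "sdim K V {\<zero>\<^bsub>V\<^esub>} = 0"
  using sdim_set_add_disjoint[OF assms subspace_zero subspace_zero] by (simp add: set_add_def')

section \<open>The rank of a direct sum\<close>

locale q_direct_summands = complementary_subspaces K E E1 E2
  for K :: "('k, 'l) ring_scheme" and E :: "('k, 'v) module" and E1 E2 :: "'v set" +
  fixes M1 M2 :: "('k, 'v) qmat"
  assumes M1: "q_matroid K M1" "ground M1 = E\<lparr>carrier := E1\<rparr>"
    and M2: "q_matroid K M2" "ground M2 = E\<lparr>carrier := E2\<rparr>"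
begin

lemma swap_summands: "q_direct_summands K E E2 E1 M2 M1"
  by (intro q_direct_summands.intro q_direct_summands_axioms.intro complementary_swap M1 M2)

lemma fin_dim_E: "fin_dim"
proof -
  have "vectorspace.fin_dim K (vs E1)" "vectorspace.fin_dim K (vs E2)"
    using q_matroid.finite_dimensional[OF M1(1)] q_matroid.finite_dimensional[OF M2(1)] M1(2) M2(2)
    by simp_all
  then show ?thesis
    using fin_dim_subspace_sum[OF subspace_P subspace_Q]
    unfolding submodule_sum_eq_set_add set_add_carrier by simp
qed

lemma subspace_ground1: "A \<in> subspaces K (ground M1) \<longleftrightarrow> subspace K A E \<and> A \<subseteq> E1"
  using subspaces_vs[OF subspace_P] by (auto simp: M1(2) subspaces_def)

lemma rank_zero1: "rank M1 {\<zero>\<^bsub>E\<^esub>} = 0"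
proof -
  have "{\<zero>\<^bsub>E\<^esub>} \<in> subspaces K (ground M1)"
    using subspace_zero subspaceD(2)[OF subspace_P] by (simp add: subspace_ground1)
  then have "0 \<le> rank M1 {\<zero>\<^bsub>E\<^esub>} \<and> rank M1 {\<zero>\<^bsub>E\<^esub>} \<le> sdim K E {\<zero>\<^bsub>E\<^esub>}"
    using q_matroid.R1[OF M1(1)] by (simp add: M1(2) sdim_def)
  then show ?thesis
    by (simp add: sdim_zero[OF fin_dim_E])
qed

lemma rank_increase1:
  assumes "subspace K A E" "subspace K B E" "A \<subseteq> B" "B \<subseteq> E1"
  shows "rank M1 B \<le> rank M1 A + (sdim K E B - sdim K E A)"
  using q_matroid.rank_increase[OF M1(1), of A B] assms subspace_ground1
  by (simp add: M1(2) sdim_def)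

lemma rank_mono1:
  assumes "subspace K A E" "subspace K B E" "A \<subseteq> B" "B \<subseteq> E1"
  shows "rank M1 A \<le> rank M1 B"
  using q_matroid.R2[OF M1(1), of A B] assms subspace_ground1 by simp

lemma q_direct_sum_commute: "q_direct_sum K E M1 M2 = q_direct_sum K E M2 M1"
  by (simp add: q_direct_sum_def q_union_def add_loops_def add.commute)

lemma ground_q_direct_sum: "ground (q_direct_sum K E M1 M2) = E"
  by (simp add: q_direct_sum_def q_union_def add_loops_def)

text \<open>
  The core of the argument. The minimum in the definition of the union is attained at \<open>X = A\<close>: passing
  from \<open>A\<close> to a smaller \<open>X\<close> gains \<open>dim A - dim X\<close> in the dimension term, and the ranks of the two
  projections cannot lose more than that.
\<close>

lemma rank_q_direct_sum_split:
  assumes A: "subspace K A E" and split: "A \<subseteq> (A \<inter> E1) <+>\<^bsub>E\<^esub> (A \<inter> E2)"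
  shows "rank (q_direct_sum K E M1 M2) A = rank M1 (A \<inter> E1) + rank M2 (A \<inter> E2)"
proof -
  interpret swapped: q_direct_summands K E E2 E1 M2 M1
    by (rule swap_summands)
  let ?p1 = "\<lambda>X. (X <+>\<^bsub>E\<^esub> E2) \<inter> E1" and ?p2 = "\<lambda>X. (X <+>\<^bsub>E\<^esub> E1) \<inter> E2"
  let ?f = "\<lambda>X. rank M1 (?p1 X) + rank M2 (?p2 X) + sdim K E A - sdim K E X"
  let ?S = "{?f X |X. X \<in> subspaces K E \<and> X \<subseteq> A}"
  have subspaces_A: "subspace K (A \<inter> E1) E" "subspace K (A \<inter> E2) E"
    using A subspace_P subspace_Q subspace_Int by auto
  have p1_A: "?p1 A = A \<inter> E1" and p2_A: "?p2 A = A \<inter> E2"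
    using projection_of_split[OF A split] swapped.projection_of_split[OF A] split
      set_add_commute[OF subspaces_A] by simp_all
  have dim_A: "sdim K E (A \<inter> E1) + sdim K E (A \<inter> E2) \<le> sdim K E A"
  proof -
    have "(A \<inter> E1) \<inter> (A \<inter> E2) = {\<zero>\<^bsub>E\<^esub>}"
      using Int_trivial subspaceD(2)[OF A] by auto
    then have "sdim K E (A \<inter> E1) + sdim K E (A \<inter> E2) = sdim K E ((A \<inter> E1) <+>\<^bsub>E\<^esub> (A \<inter> E2))"
      using sdim_set_add_disjoint[OF fin_dim_E subspaces_A] by simp
    also have "\<dots> \<le> sdim K E A"
      using subspaceD(3)[OF A]
      by (intro sdim_mono fin_dim_E subspace_set_add subspaces_A A) (auto simp: set_add_def')
    finally show ?thesis .
  qed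
  \<comment> \<open>The upper bound only serves to show that the minimum is over a finite set.\<close>
  have bounds: "rank M1 (A \<inter> E1) + rank M2 (A \<inter> E2) \<le> ?f X \<and>
      ?f X \<le> rank M1 E1 + rank M2 E2 + sdim K E A"
    if X: "X \<in> subspaces K E" "X \<subseteq> A" for X
  proof -
    have sX: "subspace K X E"
      using X by (simp add: subspaces_def)
    then have s: "subspace K (?p1 X) E" "subspace K (?p2 X) E"
      using subspace_set_add subspace_Int subspace_P subspace_Q by auto
    have "X <+>\<^bsub>E\<^esub> E2 \<subseteq> A <+>\<^bsub>E\<^esub> E2" "X <+>\<^bsub>E\<^esub> E1 \<subseteq> A <+>\<^bsub>E\<^esub> E1"
      using X(2) unfolding set_add_def' by blast+
    then have le: "?p1 X \<subseteq> A \<inter> E1" "?p2 X \<subseteq> A \<inter> E2"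
      using p1_A p2_A by blast+
    have "sdim K E X \<le> sdim K E (?p1 X <+>\<^bsub>E\<^esub> ?p2 X)"
      using subset_add_projections[OF subspaceD(1)[OF sX]] s
      by (intro sdim_mono fin_dim_E sX subspace_set_add) auto
    also have "\<dots> \<le> sdim K E (?p1 X) + sdim K E (?p2 X)"
      by (rule sdim_set_add_le[OF fin_dim_E s])
    finally have "sdim K E X \<le> sdim K E (?p1 X) + sdim K E (?p2 X)" .
    moreover have "rank M1 (A \<inter> E1) \<le> rank M1 (?p1 X) + (sdim K E (A \<inter> E1) - sdim K E (?p1 X))"
      by (rule rank_increase1[OF s(1) subspaces_A(1) le(1)]) simp
    moreover have "rank M2 (A \<inter> E2) \<le> rank M2 (?p2 X) + (sdim K E (A \<inter> E2) - sdim K E (?p2 X))"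
      by (rule swapped.rank_increase1[OF s(2) subspaces_A(2) le(2)]) simp
    moreover have "rank M1 (?p1 X) \<le> rank M1 E1"
      by (rule rank_mono1[OF s(1) subspace_P]) auto
    moreover have "rank M2 (?p2 X) \<le> rank M2 E2"
      by (rule swapped.rank_mono1[OF s(2) subspace_Q]) auto
    moreover have "0 \<le> sdim K E X"
      by (simp add: sdim_def)
    ultimately show ?thesis
      using dim_A by linarith
  qed
  have "rank (q_direct_sum K E M1 M2) A = Min ?S"
    by (simp add: q_direct_sum_def q_union_def add_loops_def M1(2) M2(2))
  also have "\<dots> = rank M1 (A \<inter> E1) + rank M2 (A \<inter> E2)"
  proof (rule Min_eqI)
    have "?S \<subseteq> {rank M1 (A \<inter> E1) + rank M2 (A \<inter> E2) .. rank M1 E1 + rank M2 E2 + sdim K E A}"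
      using bounds by auto
    then show "finite ?S"
      by (rule finite_subset) simp
    show "rank M1 (A \<inter> E1) + rank M2 (A \<inter> E2) \<le> y" if "y \<in> ?S" for y
      using that bounds by blast
    have "rank M1 (A \<inter> E1) + rank M2 (A \<inter> E2) = ?f A"
      by (simp add: p1_A p2_A)
    then show "rank M1 (A \<inter> E1) + rank M2 (A \<inter> E2) \<in> ?S"
      using A by (intro CollectI exI[of _ A]) (simp add: subspaces_def)
  qed
  finally show ?thesis .
qed

lemma rank_q_direct_sum_summand:
  assumes "subspace K A E" "A \<subseteq> E1"
  shows "rank (q_direct_sum K E M1 M2) A = rank M1 A"
proof -
  interpret swapped: q_direct_summands K E E2 E1 M2 M1
    by (rule swap_summands)
  have Int: "A \<inter> E1 = A" "A \<inter> E2 = {\<zero>\<^bsub>E\<^esub>}"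
    using assms Int_trivial subspaceD(2)[OF assms(1)] by auto
  have "rank (q_direct_sum K E M1 M2) A = rank M1 (A \<inter> E1) + rank M2 (A \<inter> E2)"
    using subset_set_add(1)[OF assms(1) subspace_zero]
    by (intro rank_q_direct_sum_split assms(1)) (simp add: Int)
  then show ?thesis
    by (simp add: Int swapped.rank_zero1)
qed

lemma rank_q_direct_sum_above_summand:
  assumes "subspace K A E" "A \<subseteq> E1"
  shows "rank (q_direct_sum K E M1 M2) (A <+>\<^bsub>E\<^esub> E2) = rank M1 A + rank M2 E2"
proof -
  have "A \<inter> E1 = A" "A \<inter> E2 = {\<zero>\<^bsub>E\<^esub>}"
    using assms Int_trivial subspaceD(2)[OF assms(1)] by auto
  then have Int1: "(A <+>\<^bsub>E\<^esub> E2) \<inter> E1 = A"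
    using projection_of_split[OF assms(1)] subset_set_add(1)[OF assms(1) subspace_zero] by simp
  have Int2: "(A <+>\<^bsub>E\<^esub> E2) \<inter> E2 = E2"
    using subset_set_add(2)[OF assms(1) subspace_Q] by blast
  show ?thesis
    using rank_q_direct_sum_split[OF subspace_set_add[OF assms(1) subspace_Q]]
    by (simp add: Int1 Int2)
qed

section \<open>The four minors\<close>

lemma q_restriction_isomorphic: "q_isomorphic K (q_restriction (q_direct_sum K E M1 M2) E1) M1"
proof (rule q_isomorphic_transport[OF M1(1)])
  interpret V1: vectorspace K "vs E1"
    by (rule subspace_is_vs[OF subspace_P])
  have "linear_map K (vs E1) (vs E1) (\<lambda>v. v)"
    by (intro linear_map.intro mod_hom.intro mod_hom_axioms.intro V1.vectorspace_axioms
        V1.module_axioms) (auto simp: LinearCombinations.module_hom_def)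
  then show "linear_bijection K (ground M1) (ground (q_restriction (q_direct_sum K E M1 M2) E1)) (\<lambda>v. v)"
    by (simp add: linear_bijection_def linear_bijection_axioms_def q_restriction_def
        ground_q_direct_sum M1(2) bij_betw_def)
  show "rank (q_restriction (q_direct_sum K E M1 M2) E1) ((\<lambda>v. v) ` A) = rank M1 A"
    if "A \<in> subspaces K (ground M1)" for A
    using that rank_q_direct_sum_summand by (simp add: q_restriction_def subspace_ground1)
qed

lemma q_contraction_isomorphic: "q_isomorphic K (q_contraction (q_direct_sum K E M1 M2) E2) M1"
proof (rule q_isomorphic_transport[OF M1(1)])
  interpret swapped: q_direct_summands K E E2 E1 M2 M1
    by (rule swap_summands)
  let ?N = "q_contraction (q_direct_sum K E M1 M2) E2" and ?T = "\<lambda>v. E2 +>\<^bsub>E\<^esub> v"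
  show "linear_bijection K (ground M1) (ground ?N) ?T"
    using linear_map_restrict[OF quotient_map_linear[OF subspace_Q] subspace_P] quotient_map_bij
    by (simp add: linear_bijection_def linear_bijection_axioms_def q_contraction_def
        ground_q_direct_sum M1(2))
  show "rank ?N (?T ` A) = rank M1 A" if "A \<in> subspaces K (ground M1)" for A
  proof -
    have A: "subspace K A E" "A \<subseteq> E1"
      using that by (auto simp: subspace_ground1)
    have "\<Union> (?T ` A) = E2 <+>\<^bsub>E\<^esub> A"
      by (auto simp: a_r_coset_def' set_add_def')
    also have "\<dots> = A <+>\<^bsub>E\<^esub> E2"
      by (rule set_add_commute[OF subspace_Q A(1)])
    finally have "rank ?N (?T ` A) = rank M1 A + rank M2 E2 - rank (q_direct_sum K E M1 M2) E2"
      by (simp add: q_contraction_def rank_q_direct_sum_above_summand[OF A])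
    also have "rank (q_direct_sum K E M1 M2) E2 = rank M2 E2"
      using swapped.rank_q_direct_sum_summand[OF subspace_Q] by (simp add: q_direct_sum_commute)
    finally show ?thesis
      by simp
  qed
qed

end

theorem corollary48:
  fixes K :: "('k, 'l) ring_scheme"
    and E :: "('k, 'v) module"
    and E1 E2 :: "'v set"
    and M1 M2 M :: "('k, 'v) qmat"
  assumes "vectorspace K E"
    and "subspace K E1 E" and "subspace K E2 E"
    and "E1 \<inter> E2 = {\<zero>\<^bsub>E\<^esub>}"
    and "E1 <+>\<^bsub>E\<^esub> E2 = carrier E"
    and "q_matroid K M1" and "ground M1 = E\<lparr>carrier := E1\<rparr>"
    and "q_matroid K M2" and "ground M2 = E\<lparr>carrier := E2\<rparr>"
    and "M = q_direct_sum K E M1 M2"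
  shows "q_isomorphic K (q_restriction M E1) M1 \<and> q_isomorphic K (q_contraction M E2) M1 \<and>
    q_isomorphic K (q_restriction M E2) M2 \<and> q_isomorphic K (q_contraction M E1) M2"
proof -
  interpret q_direct_summands K E E1 E2 M1 M2
    using assms by (intro q_direct_summands.intro complementary_subspaces.intro
        plain_vectorspace.intro complementary_subspaces_axioms.intro q_direct_summands_axioms.intro)
  interpret swapped: q_direct_summands K E E2 E1 M2 M1
    by (rule swap_summands)
  show ?thesis
    using q_restriction_isomorphic q_contraction_isomorphic
      swapped.q_restriction_isomorphic swapped.q_contraction_isomorphic
    by (simp add: assms(10) q_direct_sum_commute)
qed

end
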